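(* Let $\mathcal{X}=\{x_0,\ldots,x_m\}\subset[-1,1]$ be an increasingly ordered set of distinct nodes, $x_0<x_1<\cdots<x_m$. For $0<\alpha<1$ and $i=0,\ldots,m$ the KTI quadrature weights satisfy $$w_i^\alpha=\frac{2}{\alpha\pi}\int_{-1}^{1}\ell_i^\alpha(y)\,\frac{\sin(\alpha\pi/2)}{\sqrt{1-\sin(\alpha\pi/2)^2y^2}}\,\mathrm{d}y,$$ and the following limit relations hold for every $i=0,\ldots,m$: $$\lim_{\alpha\to0^+}w_i^\alpha=\int_{-1}^1\ell_i^0(y)\,\mathrm{d}y=\int_{-1}^1\ell_i(y)\,\mathrm{d}y$$ and $$\lim_{\alpha\to1^-}w_i^\alpha=\frac{2}{\pi}\int_{-1}^1\ell_i^1(y)\,\frac{1}{\sqrt{1-y^2}}\,\mathrm{d}y.$$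
   Context: The Kosloff Tal-Ezer map $M_\alpha:[-1,1]\to[-1,1]$ is $M_\alpha(x)=\frac{\sin(\alpha\pi x/2)}{\sin(\alpha\pi/2)}$ for $0<\alpha\le1$ and $M_0(x)=x$. For $\alpha\in[0,1]$, $\ell_i^\alpha(y)=\prod_{0\le j\le m,\ j\ne i}\frac{y-M_\alpha(x_j)}{M_\alpha(x_i)-M_\alpha(x_j)}$ is the $i$-th Lagrange polynomial on the mapped nodes $M_\alpha(x_0),\ldots,M_\alpha(x_m)$, and $\ell_i(y)=\prod_{0\le j\le m,\ j\ne i}\frac{y-x_j}{x_i-x_j}$ is the $i$-th Lagrange polynomial on the original nodes. The KTI (interpolatory Kosloff Tal-Ezer) quadrature weights are $w_i^\alpha=\int_{-1}^1\ell_i^\alpha(M_\alpha(x))\,\mathrm{d}x$. *)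

theory Defs
  imports "HOL-Analysis.Analysis"
begin

definition KT_map :: "real \<Rightarrow> real \<Rightarrow> real" where
  "KT_map \<alpha> x = (if \<alpha> = 0 then x else sin (\<alpha> * pi * x / 2) / sin (\<alpha> * pi / 2))"

definition lagrange_poly :: "nat \<Rightarrow> (nat \<Rightarrow> real) \<Rightarrow> nat \<Rightarrow> real \<Rightarrow> real" where
  "lagrange_poly m x i y = (\<Prod>j\<in>{0..m} - {i}. (y - x j) / (x i - x j))"

definition mapped_lagrange_poly :: "real \<Rightarrow> nat \<Rightarrow> (nat \<Rightarrow> real) \<Rightarrow> nat \<Rightarrow> real \<Rightarrow> real" where
  "mapped_lagrange_poly \<alpha> m x = lagrange_poly m (\<lambda>j. KT_map \<alpha> (x j))"

definition KTI_weight :: "real \<Rightarrow> nat \<Rightarrow> (nat \<Rightarrow> real) \<Rightarrow> nat \<Rightarrow> real" where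
  "KTI_weight \<alpha> m x i = integral {-1..1} (\<lambda>t. mapped_lagrange_poly \<alpha> m x i (KT_map \<alpha> t))"

end

theory Submission
  imports Defs "HOL-Probability.Sinc_Integral"
begin

text \<open>
  The weight \<open>KTI_weight \<alpha> m x i\<close> is the integral over the fixed interval \<open>{-1..1}\<close> of a function
  of \<open>t\<close> that depends on the parameter \<open>\<alpha>\<close>. Two facts about it give all the claims.

  First, the weight is a continuous function of \<open>\<alpha>\<close> on the closed interval \<open>{0..1}\<close>
  (\<open>continuous_on_KTI_weight\<close>), so that both limits are just values at an end point.
  This holds since \<open>KT_map\<close> is continuous jointly in \<open>\<alpha>\<close> and \<open>t\<close>: the apparent singularity at
  \<open>\<alpha> = 0\<close> disappears when \<open>sin u\<close> is written as \<open>u * sinc u\<close>. Distinct nodes remain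
  distinct under \<open>KT_map \<alpha>\<close> for every \<open>\<alpha>\<close> in \<open>{0..1}\<close>, so the denominators of the Lagrange
  polynomials do not vanish, and the integrand is continuous on a compact rectangle.

  Second, for \<open>0 < \<alpha> \<le> 1\<close> the substitution \<open>y = KT_map \<alpha> t\<close> produces the weight function
  (\<open>KT_map_substitution\<close>). Taking \<open>\<alpha> < 1\<close> yields the integral formula, and \<open>\<alpha> = 1\<close> yields the
  Chebyshev integral, including its absolute convergence. At \<open>\<alpha> = 0\<close> the map is the identity and
  nothing has to be substituted.
\<close>

lemma sin_half_angle_pos:
  assumes "\<alpha> \<in> {0<..1}"
  shows "sin (\<alpha> * pi / 2) > 0"
proof (rule sin_gt_zero)
  have "\<alpha> * pi \<le> 1 * pi" using assms by (intro mult_right_mono) auto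
  then show "\<alpha> * pi / 2 < pi" using pi_gt_zero by linarith
qed (use assms in auto)

text \<open>
  With \<open>sinc 0 = 1\<close>, one formula covers both branches of the definition of \<open>KT_map\<close>; this makes the
  continuity at \<open>\<alpha> = 0\<close> visible.
\<close>

lemma KT_map_eq_sinc:
  "KT_map \<alpha> t = t * sinc (\<alpha> * pi * t / 2) / sinc (\<alpha> * pi / 2)"
  by (cases "\<alpha> = 0"; cases "t = 0") (auto simp: KT_map_def)

lemma continuous_on_KT_map:
  "continuous_on ({0..1} \<times> {-1..1}) (\<lambda>(\<alpha>, t). KT_map \<alpha> t)"
proof -
  have nz: "sinc (\<alpha> * pi / 2) \<noteq> 0" if "\<alpha> \<in> {0..1}" for \<alpha> :: real
    using sin_half_angle_pos[of \<alpha>] that by (cases "\<alpha> = 0") auto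
  \<comment> \<open>\<open>sinc\<close> abbreviates a conditional expression; naming it keeps it intact in the continuity proof.\<close>
  define S where "S = sinc"
  have contS: "continuous_on UNIV S"
    unfolding S_def using isCont_sinc by (simp add: continuous_at_imp_continuous_on)
  have nzS: "S (\<alpha> * pi / 2) \<noteq> 0" if "\<alpha> \<in> {0..1}" for \<alpha>
    using nz[OF that] by (simp only: S_def not_False_eq_True)
  have "continuous_on ({0..1} \<times> {-1..1})
      (\<lambda>p. snd p * S (fst p * pi * snd p / 2) / S (fst p * pi / 2))"
    by (intro continuous_intros continuous_on_compose2[OF contS]) (auto simp: nzS)
  then show ?thesis
    unfolding case_prod_unfold KT_map_eq_sinc S_def .
qed

text \<open>
  For \<open>\<bar>t\<bar> \<le> 1\<close> the angle \<open>\<alpha> * pi * t / 2\<close> stays between \<open>- pi / 2\<close> and \<open>pi / 2\<close>, where the sine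
  increases. Hence the mapped nodes are distinct, and \<open>KT_map \<alpha>\<close> is a valid change of variables.
\<close>

lemma KT_map_strict_mono:
  assumes "\<alpha> \<in> {0..1}"
  shows "strict_mono_on {-1..1} (KT_map \<alpha>)"
proof (cases "\<alpha> = 0")
  case True
  then show ?thesis by (simp add: KT_map_def strict_mono_on_def)
next
  case False
  with assms have a: "0 < \<alpha>" "\<alpha> \<le> 1" by auto
  have bound: "\<bar>\<alpha> * pi * t / 2\<bar> \<le> pi / 2" if "t \<in> {-1..1}" for t
  proof -
    have "\<bar>\<alpha> * t\<bar> \<le> 1" using that a by (simp add: abs_mult mult_le_one abs_le_iff)
    then have "\<bar>\<alpha> * t\<bar> * (pi / 2) \<le> 1 * (pi / 2)" by (intro mult_right_mono) auto
    then show ?thesis by (simp add: abs_mult ac_simps)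
  qed
  have s: "sin (\<alpha> * pi / 2) > 0"
    using a by (intro sin_half_angle_pos) auto
  show ?thesis
  proof (rule strict_mono_onI)
    fix r t :: real assume rt: "r \<in> {-1..1}" "t \<in> {-1..1}" "r < t"
    have "sin (\<alpha> * pi * r / 2) < sin (\<alpha> * pi * t / 2)"
      using bound[OF rt(1)] bound[OF rt(2)] a rt(3)
      by (intro sin_monotone_2pi) (auto simp: abs_le_iff)
    then show "KT_map \<alpha> r < KT_map \<alpha> t"
      using False s by (simp add: KT_map_def divide_strict_right_mono)
  qed
qed

lemma KT_map_image:
  assumes "\<alpha> \<in> {0<..1}"
  shows "KT_map \<alpha> ` {-1<..<1} = {-1<..<1}"
proof -
  have mono: "strict_mono_on {-1..1} (KT_map \<alpha>)"
    using assms by (intro KT_map_strict_mono) auto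
  have s: "sin (\<alpha> * pi / 2) > 0"
    using assms by (rule sin_half_angle_pos)
  have cont: "continuous_on {-1..1} (KT_map \<alpha>)"
    using assms s by (auto intro!: continuous_intros simp: KT_map_def[abs_def])
  from s have ends: "KT_map \<alpha> (-1) = -1" "KT_map \<alpha> 1 = 1"
    using assms by (auto simp: KT_map_def)
  show ?thesis
  proof (intro equalityI subsetI)
    fix y assume "y \<in> KT_map \<alpha> ` {-1<..<1}"
    then obtain t where "t \<in> {-1<..<1}" "y = KT_map \<alpha> t" by blast
    then show "y \<in> {-1<..<1}"
      using strict_mono_onD[OF mono, of "-1" t] strict_mono_onD[OF mono, of t 1] ends by simp
  next
    fix y :: real assume y: "y \<in> {-1<..<1}"
    then obtain t where t: "-1 \<le> t" "t \<le> 1" "KT_map \<alpha> t = y"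
      using IVT'[of "KT_map \<alpha>" "-1" y 1] cont ends by auto
    with y ends have "t \<noteq> -1" "t \<noteq> 1" by auto
    with t show "y \<in> KT_map \<alpha> ` {-1<..<1}" by (intro image_eqI[of _ _ t]) auto
  qed
qed

lemma continuous_on_lagrange_poly: "continuous_on A (lagrange_poly m x i)"
  unfolding lagrange_poly_def[abs_def] divide_inverse by (intro continuous_intros)

lemma continuous_on_mapped_lagrange_poly_KT_map:
  assumes inj: "inj_on x {0..m}" and x: "x ` {0..m} \<subseteq> {-1..1}" and i: "i \<in> {0..m}"
  shows "continuous_on ({0..1} \<times> {-1..1})
           (\<lambda>(\<alpha>, t). mapped_lagrange_poly \<alpha> m x i (KT_map \<alpha> t))"
proof -
  have node: "continuous_on ({0..1} \<times> {-1..1}) (\<lambda>p::real \<times> real. KT_map (fst p) (x j))"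
    if "j \<in> {0..m}" for j
  proof -
    have "continuous_on ({0..1} \<times> {-1..1}) (\<lambda>p::real \<times> real. (fst p, x j))"
      by (intro continuous_intros)
    moreover have "x j \<in> {-1..1}" using that x by (simp add: image_subset_iff)
    ultimately show ?thesis
      using continuous_on_compose2[OF continuous_on_KT_map,
          of "{0..1} \<times> {-1..1}" "\<lambda>p::real \<times> real. (fst p, x j)"]
      by (auto simp: image_subset_iff)
  qed
  have "KT_map \<alpha> (x i) - KT_map \<alpha> (x j) \<noteq> 0" if "\<alpha> \<in> {0..1}" "j \<in> {0..m} - {i}" for \<alpha> j
    using strict_mono_on_imp_inj_on[OF KT_map_strict_mono[OF that(1)]] inj i that x
    by (auto dest!: inj_onD)
  then show ?thesis
    unfolding mapped_lagrange_poly_def lagrange_poly_def case_prod_unfold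
    using continuous_on_KT_map[unfolded case_prod_unfold] i
    by (intro continuous_intros node) auto
qed

text \<open>
  The closed parameter interval matters: both end points are included, so that the limits of the
  weights can be evaluated by inserting \<open>\<alpha> = 0\<close> and \<open>\<alpha> = 1\<close>.
\<close>

lemma continuous_on_KTI_weight:
  assumes "inj_on x {0..m}" "x ` {0..m} \<subseteq> {-1..1}" "i \<in> {0..m}"
  shows "continuous_on {0..1} (\<lambda>\<alpha>. KTI_weight \<alpha> m x i)"
  unfolding KTI_weight_def cbox_interval[symmetric]
  using continuous_on_mapped_lagrange_poly_KT_map[OF assms]
  by (intro integral_continuous_on_param) simp

text \<open>
  For \<open>y = KT_map \<alpha> t\<close> one has \<open>1 - s\<^sup>2 * y\<^sup>2 = (cos (\<alpha> * pi * t / 2))\<^sup>2\<close>, so the weight function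
  \<open>s / sqrt (1 - s\<^sup>2 * y\<^sup>2)\<close> cancels the derivative of \<open>KT_map \<alpha>\<close> up to the factor \<open>\<alpha> * pi / 2\<close>.
  For \<open>\<alpha> = 1\<close> the weight function is unbounded near \<open>y = 1\<close> and \<open>y = -1\<close>; its integrability against
  \<open>f\<close> comes from the change of variables itself, since the pulled-back integrand is continuous.
\<close>

lemma KT_map_substitution:
  fixes f :: "real \<Rightarrow> real"
  assumes \<alpha>: "\<alpha> \<in> {0<..1}" and f: "continuous_on {-1..1} f"
  defines "s \<equiv> sin (\<alpha> * pi / 2)"
  shows "(\<lambda>y. f y * (s / sqrt (1 - s\<^sup>2 * y\<^sup>2))) absolutely_integrable_on {-1..1}"
    and "integral {-1..1} (\<lambda>t. f (KT_map \<alpha> t)) =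
           2 / (\<alpha> * pi) * integral {-1..1} (\<lambda>y. f y * (s / sqrt (1 - s\<^sup>2 * y\<^sup>2)))"
proof -
  define h where "h = (\<lambda>y. f y * (s / sqrt (1 - s\<^sup>2 * y\<^sup>2)))"
  define M' where "M' = (\<lambda>t. \<alpha> * pi / 2 * cos (\<alpha> * pi * t / 2) / s)"
  \<comment> \<open>For \<open>\<alpha> = 1\<close> the derivative vanishes at both end points, and there the cancellation fails. The
    substitution is therefore carried out on the open interval.\<close>
  let ?I = "{-1<..<1::real}"
  have s: "s > 0"
    unfolding s_def using \<alpha> by (rule sin_half_angle_pos)
  have cos_pos: "cos (\<alpha> * pi * t / 2) > 0" if "t \<in> ?I" for t
  proof -
    have "\<bar>\<alpha>\<bar> * \<bar>t\<bar> \<le> 1 * \<bar>t\<bar>"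
      using \<alpha> by (intro mult_right_mono) auto
    then have "\<bar>\<alpha> * t\<bar> < 1"
      using that by (auto simp: abs_mult)
    then have "\<bar>\<alpha> * t\<bar> * (pi / 2) < 1 * (pi / 2)" by (intro mult_strict_right_mono) auto
    then have "\<bar>\<alpha> * pi * t / 2\<bar> < pi / 2" by (simp add: abs_mult ac_simps)
    then show ?thesis by (intro cos_gt_zero_pi) (auto simp: abs_less_iff)
  qed
  have deriv: "(KT_map \<alpha> has_field_derivative M' t) (at t within ?I)" for t
    unfolding KT_map_def[abs_def] M'_def s_def
    using \<alpha> s by (auto intro!: derivative_eq_intros simp: s_def)
  have inj: "inj_on (KT_map \<alpha>) ?I"
  proof (rule inj_on_subset)
    show "inj_on (KT_map \<alpha>) {-1..1}"
      using \<alpha> by (intro strict_mono_on_imp_inj_on[OF KT_map_strict_mono]) auto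
  qed auto
  have pullback: "\<bar>M' t\<bar> * h (KT_map \<alpha> t) = \<alpha> * pi / 2 * f (KT_map \<alpha> t)" if t: "t \<in> ?I" for t
  proof -
    have "1 - s\<^sup>2 * (KT_map \<alpha> t)\<^sup>2 = (cos (\<alpha> * pi * t / 2))\<^sup>2"
      using \<alpha> s by (simp add: KT_map_def s_def[symmetric] power_divide cos_squared_eq)
    then show ?thesis
      using cos_pos[OF t] s \<alpha> by (simp add: h_def M'_def)
  qed
  have cont: "continuous_on {-1..1} (\<lambda>t. \<alpha> * pi / 2 * f (KT_map \<alpha> t))"
  proof (intro continuous_intros continuous_on_compose2[OF f])
    show c: "continuous_on {-1..1} (KT_map \<alpha>)"
      using \<alpha> s by (auto intro!: continuous_intros simp: KT_map_def[abs_def] s_def)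
    show "KT_map \<alpha> ` {-1..1} \<subseteq> {-1..1}"
      using image_closure_subset[of ?I "KT_map \<alpha>" "{-1..1}"] c KT_map_image[OF \<alpha>]
      by (simp add: greaterThanLessThan_subseteq_atLeastAtMost_iff)
  qed
  have ae: "g absolutely_integrable_on ?I \<longleftrightarrow> g absolutely_integrable_on {-1..1}" for g :: "real \<Rightarrow> real"
    by (rule absolutely_integrable_spike_set_eq; rule negligible_subset[of "{-1, 1}"]) auto
  have "(\<lambda>t. \<alpha> * pi / 2 * f (KT_map \<alpha> t)) absolutely_integrable_on ?I"
    unfolding ae using cont by (rule absolutely_integrable_continuous_real)
  moreover have "((\<lambda>t. \<bar>M' t\<bar> * h (KT_map \<alpha> t)) absolutely_integrable_on ?I) \<longleftrightarrow>
     ((\<lambda>t. \<alpha> * pi / 2 * f (KT_map \<alpha> t)) absolutely_integrable_on ?I)"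
    by (intro set_integrable_cong refl pullback)
  moreover have "integral ?I (\<lambda>t. \<bar>M' t\<bar> * h (KT_map \<alpha> t)) =
     integral {-1..1} (\<lambda>t. \<alpha> * pi / 2 * f (KT_map \<alpha> t))"
    unfolding integral_open_interval_real by (intro integral_cong pullback)
  ultimately have "h absolutely_integrable_on ?I \<and>
      integral ?I h = integral {-1..1} (\<lambda>t. \<alpha> * pi / 2 * f (KT_map \<alpha> t))"
    using has_absolute_integral_change_of_variables_1'[OF _ deriv inj, of h] KT_map_image[OF \<alpha>]
    by (metis lmeasurable_interval(2) fmeasurableD)
  then show "(\<lambda>y. f y * (s / sqrt (1 - s\<^sup>2 * y\<^sup>2))) absolutely_integrable_on {-1..1}"
    and "integral {-1..1} (\<lambda>t. f (KT_map \<alpha> t)) =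
           2 / (\<alpha> * pi) * integral {-1..1} (\<lambda>y. f y * (s / sqrt (1 - s\<^sup>2 * y\<^sup>2)))"
    using \<alpha> by (auto simp: ae integral_open_interval_real h_def field_simps)
qed

theorem theorem3:
  fixes m :: nat and x :: "nat \<Rightarrow> real"
  assumes nodes_increasing: "strict_mono_on {0..m} x"
    and nodes_in_interval: "x ` {0..m} \<subseteq> {-1..1}"
  shows "(\<forall>\<alpha>. 0 < \<alpha> \<and> \<alpha> < 1 \<longrightarrow> (\<forall>i\<in>{0..m}.
            KTI_weight \<alpha> m x i =
              2 / (\<alpha> * pi) * integral {-1..1} (\<lambda>y. mapped_lagrange_poly \<alpha> m x i y *
                 (sin (\<alpha> * pi / 2) / sqrt (1 - (sin (\<alpha> * pi / 2))\<^sup>2 * y\<^sup>2)))))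
       \<and> (\<forall>i\<in>{0..m}.
            ((\<lambda>\<alpha>. KTI_weight \<alpha> m x i) \<longlongrightarrow>
               integral {-1..1} (mapped_lagrange_poly 0 m x i)) (at_right 0)
          \<and> integral {-1..1} (mapped_lagrange_poly 0 m x i) =
               integral {-1..1} (lagrange_poly m x i))
       \<and> (\<forall>i\<in>{0..m}.
            (\<lambda>y. mapped_lagrange_poly 1 m x i y * (1 / sqrt (1 - y\<^sup>2))) absolutely_integrable_on {-1..1}
          \<and> ((\<lambda>\<alpha>. KTI_weight \<alpha> m x i) \<longlongrightarrow>
               2 / pi * integral {-1..1} (\<lambda>y. mapped_lagrange_poly 1 m x i y * (1 / sqrt (1 - y\<^sup>2))))
              (at_left 1))"
proof -
  have inj: "inj_on x {0..m}"
    using nodes_increasing by (rule strict_mono_on_imp_inj_on)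
  have subst: "KTI_weight \<alpha> m x i =
              2 / (\<alpha> * pi) * integral {-1..1} (\<lambda>y. mapped_lagrange_poly \<alpha> m x i y *
                 (sin (\<alpha> * pi / 2) / sqrt (1 - (sin (\<alpha> * pi / 2))\<^sup>2 * y\<^sup>2)))"
    if "\<alpha> \<in> {0<..1}" for \<alpha> i
    unfolding KTI_weight_def mapped_lagrange_poly_def
    by (intro KT_map_substitution(2) that continuous_on_lagrange_poly)
  have integrable: "(\<lambda>y. mapped_lagrange_poly 1 m x i y * (1 / sqrt (1 - y\<^sup>2)))
      absolutely_integrable_on {-1..1}" for i
    using KT_map_substitution(1)[of 1, OF _ continuous_on_lagrange_poly]
    by (simp add: mapped_lagrange_poly_def)
  have lim0: "((\<lambda>\<alpha>. KTI_weight \<alpha> m x i) \<longlongrightarrow> KTI_weight 0 m x i) (at_right 0)"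
    and lim1: "((\<lambda>\<alpha>. KTI_weight \<alpha> m x i) \<longlongrightarrow> KTI_weight 1 m x i) (at_left 1)"
    if "i \<in> {0..m}" for i
    using continuous_on_KTI_weight[OF inj nodes_in_interval that]
    using continuous_on_Icc_at_rightD[of 0 1 "\<lambda>\<alpha>. KTI_weight \<alpha> m x i"]
      continuous_on_Icc_at_leftD[of 0 1 "\<lambda>\<alpha>. KTI_weight \<alpha> m x i"] by simp_all
  have w0: "KTI_weight 0 m x i = integral {-1..1} (mapped_lagrange_poly 0 m x i)"
    and l0: "mapped_lagrange_poly 0 m x i = lagrange_poly m x i" for i
    by (simp_all add: KTI_weight_def mapped_lagrange_poly_def KT_map_def)
  show ?thesis
    using subst integrable lim0 lim1 subst[of 1] by (auto simp: w0 l0)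
qed

end
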